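(* There is a dichotomy on the existence of a steady state of system (S): if $$\int_0^{\Phi_F}\frac1{K(\phi)}\,d\phi>1,$$ then there exists a unique steady state of (S). Otherwise, if $$\int_0^{\Phi_F}\frac1{K(\phi)}\,d\phi\le1,$$ then there is no steady state of (S).
   Context: Standing assumptions: $\Phi_F>0$ is fixed and $K\in C^2(\mathbb{R})$ is a function with $K',K''$ bounded on $\mathbb{R}$ and $K(\phi)>0$ for $\phi\in[0,\Phi_F]$. System (S), for unknowns $Q(\tau,\eta)$ and $N(\tau)>0$: $$\partial_\tau Q+\partial_\eta Q=\frac1{N(\tau)}+K(Q)\quad(\tau>0,\ \eta\in(0,1)),\qquad Q(\tau,0)=0,\qquad \frac1{N(\tau)}=\partial_\eta Q(\tau,1)-K(\Phi_F)\quad(\tau>0),$$ with $K(\Phi_F)<\partial_\eta Q(\tau,1)<+\infty$, where classical solutions satisfy $Q(\tau,1)=\Phi_F$. A steady state of (S) is a time-independent classical solution, i.e. a pair $(Q^*,N^* )$ with $Q^*\in C^1[0,1]$ and $N^*\in(0,+\infty)$ such that $$\frac{d}{d\eta}Q^*(\eta)=K(Q^*(\eta))+\frac1{N^*}\ (\eta\in[0,1]),\qquad Q^*(0)=0,\quad Q^*(1)=\Phi_F .$$ *)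

theory Defs
  imports "HOL-Analysis.Analysis"
begin

text \<open>The derivative is taken within the set, hence one-sided at the endpoints of a closed
  interval; the library's \<open>C1_differentiable_on\<close> uses two-sided derivatives, which would
  constrain the function outside the interval.\<close>

definition C1_on :: "(real \<Rightarrow> real) \<Rightarrow> real set \<Rightarrow> bool" where
  "C1_on f S \<longleftrightarrow>
     (\<exists>f'. (\<forall>x\<in>S. (f has_real_derivative f' x) (at x within S)) \<and> continuous_on S f')"

definition C2_real :: "(real \<Rightarrow> real) \<Rightarrow> bool" where
  "C2_real f \<longleftrightarrow> C1_on f UNIV \<and> C1_on (deriv f) UNIV"

text \<open>Only the values of \<open>Q\<close> on \<open>[0,1]\<close> are constrained, so two steady states are the same
  when their \<open>N\<close> coincide and their \<open>Q\<close> agree on \<open>[0,1]\<close>.\<close>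

definition steady_state ::
    "(real \<Rightarrow> real) \<Rightarrow> real \<Rightarrow> (real \<Rightarrow> real) \<Rightarrow> real \<Rightarrow> bool" where
  "steady_state K \<Phi> Q N \<longleftrightarrow>
     C1_on Q {0..1} \<and> 0 < N \<and>
     (\<forall>\<eta>\<in>{0..1}. (Q has_real_derivative K (Q \<eta>) + 1 / N) (at \<eta> within {0..1})) \<and>
     Q 0 = 0 \<and> Q 1 = \<Phi>"

end

theory Submission
  imports Defs
begin

text \<open>A steady state moves from \<open>0\<close> to \<open>\<Phi>\<close> with velocity \<open>K(\<phi>) + 1/N\<close> at position \<open>\<phi>\<close>, so by
  separation of variables \<open>\<integral>\<^sub>0\<^bsup>Q(\<eta>)\<^esup> d\<phi> / (K(\<phi>) + 1/N) = \<eta>\<close>. Hence steady states correspond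
  to the numbers \<open>c = 1/N > 0\<close> for which the total travel time
  \<open>T(c) = \<integral>\<^sub>0\<^bsup>\<Phi>\<^esup> d\<phi> / (K(\<phi>) + c)\<close> equals \<open>1\<close> (\<open>travel_time_along_steady_state\<close> and
  \<open>steady_state_of_travel_time\<close>). Since \<open>T\<close> is continuous and strictly decreasing on
  \<open>[0,\<infinity>)\<close>, starts at \<open>T(0) = \<integral>\<^sub>0\<^bsup>\<Phi>\<^esup> 1/K\<close> and satisfies \<open>T(\<Phi>) < 1\<close>, there is such a \<open>c\<close>
  precisely when \<open>T(0) > 1\<close>, and it is then unique. It determines \<open>Q\<close>, because the travel time is
  strictly increasing in the position reached.

  Separation of variables needs positive velocity along the solution, whereas \<open>K\<close> may be
  negative outside \<open>[0,\<Phi>]\<close>. A steady state never leaves \<open>[0,\<Phi>]\<close>: the velocity is positive at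
  the two endpoints, so neither level can be crossed downwards
  (\<open>no_downward_crossing\<close>).\<close>

section \<open>Levels that a trajectory cannot cross downwards\<close>

text \<open>If the trajectory were below the level at a later time, then at the last time before that
  at which it is on the level it would have to be non-increasing.\<close>

lemma no_downward_crossing:
  fixes R R' :: "real \<Rightarrow> real"
  assumes der: "\<And>t. t \<in> {u..v} \<Longrightarrow> (R has_real_derivative R' t) (at t within {u..v})"
    and up: "\<And>t. t \<in> {u..v} \<Longrightarrow> R t = a \<Longrightarrow> 0 < R' t"
    and "u < v" "a \<le> R u"
  shows "a < R v"
proof (rule ccontr)
  assume "\<not> a < R v"
  have cont: "continuous_on {u..v} R"
    by (rule DERIV_continuous_on[OF der])
  \<comment> \<open>If \<open>R\<close> ends exactly on the level, it comes from strictly below it.\<close>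
  obtain w where w: "u < w" "w \<le> v" "R w < a"
  proof (cases "R v = a")
    case True
    obtain d where d: "d > 0" "\<And>h. 0 < h \<Longrightarrow> v - h \<in> {u..v} \<Longrightarrow> h < d \<Longrightarrow> R (v - h) < R v"
      using has_real_derivative_pos_inc_left[OF der[of v] up[of v]] True \<open>u < v\<close> by auto
    define h where "h = min d (v - u) / 2"
    have "0 < h" "h < d" "h < v - u"
      using d(1) \<open>u < v\<close> by (auto simp: h_def min_def)
    then show ?thesis
      using d(2)[of h] True that[of "v - h"] by simp
  next
    case False
    then show ?thesis using that[of v] \<open>\<not> a < R v\<close> \<open>u < v\<close> by auto
  qed
  define S where "S = {t \<in> {u..w}. R t \<in> {a..}}"
  have contw: "continuous_on {u..w} R"
    using cont w by (auto intro: continuous_on_subset)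
  have "compact S"
    unfolding S_def compact_eq_bounded_closed
    using continuous_closed_preimage[OF contw closed_atLeastAtMost closed_atLeast]
    by (auto simp: vimage_def Int_def intro: bounded_subset[OF bounded_closed_interval])
  moreover have "u \<in> S" using assms(4) w by (auto simp: S_def)
  ultimately obtain s where s: "s \<in> S" "\<And>t. t \<in> S \<Longrightarrow> t \<le> s"
    using compact_attains_sup[of S] by blast
  have "s < w" using s(1) w by (auto simp: S_def order.order_iff_strict)
  \<comment> \<open>Otherwise the level would be attained again between \<open>s\<close> and \<open>w\<close>.\<close>
  have "R s = a"
  proof -
    obtain t where t: "s \<le> t" "t \<le> w" "R t = a"
      using IVT2'[of R w a s] s(1) w \<open>s < w\<close> continuous_on_subset[OF contw, of "{s..w}"]
      by (auto simp: S_def)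
    then have "t \<in> S" using s(1) by (auto simp: S_def)
    then show ?thesis using s(2)[of t] t by simp
  qed
  have "s \<in> {u..v}" using s(1) w by (auto simp: S_def)
  obtain d where d: "d > 0" "\<And>h. 0 < h \<Longrightarrow> s + h \<in> {u..v} \<Longrightarrow> h < d \<Longrightarrow> R s < R (s + h)"
    using has_real_derivative_pos_inc_right[OF der up] \<open>R s = a\<close> \<open>s \<in> {u..v}\<close> by metis
  define h where "h = min d (w - s) / 2"
  have "0 < h" "h < d" "h < w - s"
    using d(1) \<open>s < w\<close> by (auto simp: h_def min_def)
  then have "s + h \<in> S"
    using d(2)[of h] \<open>R s = a\<close> \<open>s \<in> {u..v}\<close> w by (auto simp: S_def)
  then show False using s(2) \<open>0 < h\<close> by fastforce
qed

text \<open>The level \<open>0\<close>, where the trajectory starts, keeps it nonnegative. If it exceeded \<open>\<Phi>\<close> at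
  some time, the level \<open>\<Phi>\<close> would keep it strictly above \<open>\<Phi>\<close> up to time \<open>1\<close>, when it has to be
  at \<open>\<Phi>\<close>.\<close>

lemma trajectory_stays_between_endpoints:
  fixes R g :: "real \<Rightarrow> real"
  assumes der: "\<And>t. t \<in> {0..1} \<Longrightarrow> (R has_real_derivative g (R t)) (at t within {0..1})"
    and "0 < g 0" "0 < g \<Phi>" "R 0 = 0" "R 1 = \<Phi>" and \<eta>: "\<eta> \<in> {0..1}"
  shows "R \<eta> \<in> {0..\<Phi>}"
proof -
  have der': "(R has_real_derivative g (R t)) (at t within {u..v})"
    if "t \<in> {u..v}" "{u..v} \<subseteq> {0..1}" for t u v
    using DERIV_subset[OF der, of t "{u..v}"] that by blast
  have "0 \<le> R \<eta>"
  proof (cases "\<eta> = 0")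
    case False
    then have "0 < R \<eta>"
      using \<eta> assms by (intro no_downward_crossing[OF der', of 0 \<eta>]) auto
    then show ?thesis by simp
  qed (use assms in simp)
  moreover have "R \<eta> \<le> \<Phi>"
  proof (rule ccontr)
    assume "\<not> R \<eta> \<le> \<Phi>"
    moreover from this have "\<eta> < 1" using \<eta> assms by (auto simp: order.order_iff_strict)
    ultimately have "\<Phi> < R 1"
      using \<eta> assms by (intro no_downward_crossing[OF der', of \<eta> 1]) auto
    then show False using assms by simp
  qed
  ultimately show ?thesis by simp
qed

section \<open>Travel time\<close>

text \<open>The time that a point moving with velocity \<open>g \<phi>\<close> at position \<open>\<phi>\<close> needs to get from \<open>0\<close>
  to \<open>q\<close>.\<close>

definition travel_time :: "(real \<Rightarrow> real) \<Rightarrow> real \<Rightarrow> real" where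
  "travel_time g q = integral {0..q} (\<lambda>\<phi>. 1 / g \<phi>)"

lemma travel_time_0 [simp]: "travel_time g 0 = 0"
  by (simp add: travel_time_def)

locale positive_velocity =
  fixes g :: "real \<Rightarrow> real" and \<Phi> :: real
  assumes cont: "continuous_on {0..\<Phi>} g"
    and pos: "\<And>\<phi>. \<phi> \<in> {0..\<Phi>} \<Longrightarrow> 0 < g \<phi>"
    and \<Phi>_pos: "0 < \<Phi>"
begin

lemma continuous_on_slowness: "continuous_on {0..\<Phi>} (\<lambda>\<phi>. 1 / g \<phi>)"
  using pos by (intro continuous_intros cont) force

lemma travel_time_derivative:
  assumes "q \<in> {0..\<Phi>}"
  shows "(travel_time g has_real_derivative 1 / g q) (at q within {0..\<Phi>})"
  using integral_has_real_derivative[OF continuous_on_slowness assms]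
  by (simp add: travel_time_def[abs_def])

lemma continuous_on_travel_time: "continuous_on {0..\<Phi>} (travel_time g)"
  by (rule DERIV_continuous_on[OF travel_time_derivative])

lemma travel_time_strict_mono: "strict_mono_on {0..\<Phi>} (travel_time g)"
proof (rule strict_mono_onI)
  fix p q assume pq: "p \<in> {0..\<Phi>}" "q \<in> {0..\<Phi>}" "p < q"
  have "(travel_time g has_real_derivative 1 / g x) (at x within {p..q})" if "x \<in> {p..q}" for x
    using DERIV_subset[OF travel_time_derivative, of x "{p..q}"] that pq by auto
  \<comment> \<open>A function with positive derivative crosses no level downwards, here \<open>travel_time g p\<close>.\<close>
  then show "travel_time g p < travel_time g q"
    using pq pos by (intro no_downward_crossing[of p q "travel_time g" "\<lambda>x. 1 / g x"]) auto
qed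

text \<open>By the chain rule, the travel time to the current position grows at rate
  \<open>(1 / g) \<cdot> g = 1\<close>.\<close>

lemma travel_time_along_trajectory:
  assumes der: "\<And>t. t \<in> {0..1} \<Longrightarrow> (R has_real_derivative g (R t)) (at t within {0..1})"
    and "R 0 = 0" "R 1 = \<Phi>" and \<eta>: "\<eta> \<in> {0..1}"
  shows "travel_time g (R \<eta>) = \<eta>"
proof -
  have range: "R ` {0..1} \<subseteq> {0..\<Phi>}"
    using trajectory_stays_between_endpoints[OF der] pos \<Phi>_pos assms(2,3) by force
  have "((\<lambda>t. travel_time g (R t) - t) has_real_derivative 0) (at t within {0..1})"
    if t: "t \<in> {0..1}" for t
  proof -
    have q: "R t \<in> {0..\<Phi>}" using range t by blast
    have "(travel_time g \<circ> R has_real_derivative 1 / g (R t) * g (R t)) (at t within {0..1})"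
      using DERIV_subset[OF travel_time_derivative[OF q] range] der[OF t]
      by (rule DERIV_image_chain)
    then show ?thesis
      using pos[OF q] by (auto intro!: derivative_eq_intros simp: comp_def)
  qed
  then obtain c where "\<forall>t\<in>{0..1}. travel_time g (R t) - t = c"
    using has_field_derivative_zero_constant[of "{0..1}"] by fastforce
  then show ?thesis using \<eta> assms(2) by (metis atLeastAtMost_iff diff_0_right eq_iff_diff_eq_0
        travel_time_0 zero_le_one order_refl)
qed

text \<open>Conversely, inverting the travel time yields a trajectory. The inverse function theorem
  within a set gives the one-sided derivatives at the ends.\<close>

lemma trajectory_of_travel_time:
  assumes T: "travel_time g \<Phi> = 1"
  obtains R where "\<And>t. t \<in> {0..1} \<Longrightarrow> (R has_real_derivative g (R t)) (at t within {0..1})"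
    "R 0 = 0" "R 1 = \<Phi>" "R ` {0..1} = {0..\<Phi>}"
proof -
  let ?T = "travel_time g"
  define R where "R = the_inv_into {0..\<Phi>} ?T"
  have inj: "inj_on ?T {0..\<Phi>}"
    using travel_time_strict_mono by (rule strict_mono_on_imp_inj_on)
  have RT: "R (?T q) = q" if "q \<in> {0..\<Phi>}" for q
    using the_inv_into_f_f[OF inj that] by (simp add: R_def)
  have image: "?T ` {0..\<Phi>} = {0..1}"
  proof
    show "?T ` {0..\<Phi>} \<subseteq> {0..1}"
      using strict_mono_on_leD[OF travel_time_strict_mono, of 0]
        strict_mono_on_leD[OF travel_time_strict_mono, of _ \<Phi>] T \<Phi>_pos by auto
    show "{0..1} \<subseteq> ?T ` {0..\<Phi>}"
    proof
      fix t :: real assume "t \<in> {0..1}"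
      then show "t \<in> ?T ` {0..\<Phi>}"
        using IVT'[of ?T 0 t \<Phi>] continuous_on_travel_time T \<Phi>_pos by fastforce
    qed
  qed
  have contR: "continuous_on {0..1} R"
    using continuous_on_inv_into[OF continuous_on_travel_time _ inj] image
    by (simp add: R_def)
  have "(R has_real_derivative g (R t)) (at t within {0..1})" if t: "t \<in> {0..1}" for t
  proof -
    obtain q where q: "q \<in> {0..\<Phi>}" "t = ?T q" using t image by blast
    have "(R has_derivative (*) (g q)) (at (?T q) within ?T ` {0..\<Phi>})"
    proof (rule has_derivative_inverse_within)
      show "(?T has_derivative (*) (1 / g q)) (at q within {0..\<Phi>})"
        using travel_time_derivative[OF q(1)] by (simp add: has_field_derivative_def)
      show "continuous (at (?T q) within ?T ` {0..\<Phi>}) R"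
        using contR t q(2) image by (simp add: continuous_on_eq_continuous_within)
      show "(*) (g q) \<circ> (*) (1 / g q) = id"
        using pos[OF q(1)] by (auto simp: fun_eq_iff)
    qed (use q RT in \<open>auto intro: linearI simp: algebra_simps\<close>)
    then show ?thesis
      using q RT image by (simp add: has_field_derivative_def)
  qed
  moreover have "R 0 = 0" "R 1 = \<Phi>"
    using RT[of 0] RT[of \<Phi>] T \<Phi>_pos by auto
  moreover have "R ` {0..1} = {0..\<Phi>}"
    unfolding image[symmetric] image_image using RT by simp
  ultimately show ?thesis by (rule that)
qed

end

section \<open>Steady states and the total travel time\<close>

lemma positive_velocity_shift:
  fixes K :: "real \<Rightarrow> real"
  assumes "continuous_on {0..\<Phi>} K" "\<And>\<phi>. \<phi> \<in> {0..\<Phi>} \<Longrightarrow> 0 < K \<phi>" "0 < \<Phi>" "0 \<le> c"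
  shows "positive_velocity (\<lambda>\<phi>. K \<phi> + c) \<Phi>"
proof
  show "continuous_on {0..\<Phi>} (\<lambda>\<phi>. K \<phi> + c)"
    by (intro continuous_on_add assms(1) continuous_on_const)
  show "0 < K \<phi> + c" if "\<phi> \<in> {0..\<Phi>}" for \<phi>
    using assms(2)[OF that] assms(4) by simp
qed (rule assms(3))

lemma travel_time_along_steady_state:
  assumes "continuous_on {0..\<Phi>} K" "\<And>\<phi>. \<phi> \<in> {0..\<Phi>} \<Longrightarrow> 0 < K \<phi>" "0 < \<Phi>"
    and R: "steady_state K \<Phi> R N" and \<eta>: "\<eta> \<in> {0..1}"
  shows "R \<eta> \<in> {0..\<Phi>}" and "travel_time (\<lambda>\<phi>. K \<phi> + 1 / N) (R \<eta>) = \<eta>"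
proof -
  have "0 < N" using R unfolding steady_state_def by blast
  interpret positive_velocity "\<lambda>\<phi>. K \<phi> + 1 / N" \<Phi>
    using \<open>0 < N\<close> by (intro positive_velocity_shift assms(1-3)) auto
  have der: "\<And>t. t \<in> {0..1} \<Longrightarrow> (R has_real_derivative K (R t) + 1 / N) (at t within {0..1})"
    and ends: "R 0 = 0" "R 1 = \<Phi>"
    using R unfolding steady_state_def by blast+
  have "0 < K 0 + 1 / N" "0 < K \<Phi> + 1 / N"
    using pos[of 0] pos[of \<Phi>] \<Phi>_pos by auto
  from trajectory_stays_between_endpoints[where g = "\<lambda>\<phi>. K \<phi> + 1 / N", OF der this ends \<eta>]
  show "R \<eta> \<in> {0..\<Phi>}" by simp
  from travel_time_along_trajectory[OF der ends \<eta>]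
  show "travel_time (\<lambda>\<phi>. K \<phi> + 1 / N) (R \<eta>) = \<eta>" by simp
qed

lemma steady_state_determined_by_N:
  assumes "continuous_on {0..\<Phi>} K" "\<And>\<phi>. \<phi> \<in> {0..\<Phi>} \<Longrightarrow> 0 < K \<phi>" "0 < \<Phi>"
    and R: "steady_state K \<Phi> R N" and Q: "steady_state K \<Phi> Q N" and \<eta>: "\<eta> \<in> {0..1}"
  shows "R \<eta> = Q \<eta>"
proof -
  have "0 < N" using R unfolding steady_state_def by blast
  interpret positive_velocity "\<lambda>\<phi>. K \<phi> + 1 / N" \<Phi>
    using \<open>0 < N\<close> by (intro positive_velocity_shift assms(1-3)) auto
  note R = travel_time_along_steady_state[OF assms(1-3) R \<eta>]
  note Q = travel_time_along_steady_state[OF assms(1-3) Q \<eta>]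
  show ?thesis
    using inj_onD[OF strict_mono_on_imp_inj_on[OF travel_time_strict_mono] _ R(1) Q(1)] R(2) Q(2)
    by simp
qed

lemma steady_state_of_travel_time:
  assumes "continuous_on {0..\<Phi>} K" "\<And>\<phi>. \<phi> \<in> {0..\<Phi>} \<Longrightarrow> 0 < K \<phi>" "0 < \<Phi>"
    and N: "0 < N" and T: "travel_time (\<lambda>\<phi>. K \<phi> + 1 / N) \<Phi> = 1"
  shows "\<exists>Q. steady_state K \<Phi> Q N"
proof -
  interpret positive_velocity "\<lambda>\<phi>. K \<phi> + 1 / N" \<Phi>
    using N by (intro positive_velocity_shift assms(1-3)) auto
  obtain Q where
    Q: "\<And>t. t \<in> {0..1} \<Longrightarrow> (Q has_real_derivative K (Q t) + 1 / N) (at t within {0..1})"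
    "Q 0 = 0" "Q 1 = \<Phi>" "Q ` {0..1} = {0..\<Phi>}"
    using trajectory_of_travel_time[OF T] by blast
  have "continuous_on {0..1} Q" by (rule DERIV_continuous_on[OF Q(1)])
  then have "continuous_on {0..1} (\<lambda>t. K (Q t) + 1 / N)"
    by (rule continuous_on_compose2[OF cont]) (simp add: Q(4))
  then have "C1_on Q {0..1}"
    unfolding C1_on_def using Q(1) by (intro exI[of _ "\<lambda>t. K (Q t) + 1 / N"] conjI ballI)
  then show ?thesis using Q(1-3) N unfolding steady_state_def by (intro exI[of _ Q] conjI ballI)
qed

lemma total_travel_time_strict_antimono:
  fixes K :: "real \<Rightarrow> real"
  assumes "continuous_on {0..\<Phi>} K" "\<And>\<phi>. \<phi> \<in> {0..\<Phi>} \<Longrightarrow> 0 < K \<phi>" "0 < \<Phi>"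
    and "0 \<le> c" "c < d"
  shows "travel_time (\<lambda>\<phi>. K \<phi> + d) \<Phi> < travel_time (\<lambda>\<phi>. K \<phi> + c) \<Phi>"
  unfolding travel_time_def
proof (rule integral_less_real)
  have "continuous_on {0..\<Phi>} (\<lambda>\<phi>. 1 / (K \<phi> + e))" if "0 \<le> e" for e
    using positive_velocity.continuous_on_slowness[OF positive_velocity_shift[OF assms(1-3) that]] .
  then show "continuous_on {0..\<Phi>} (\<lambda>\<phi>. 1 / (K \<phi> + d))"
    "continuous_on {0..\<Phi>} (\<lambda>\<phi>. 1 / (K \<phi> + c))" using assms by auto
  show "1 / (K \<phi> + d) < 1 / (K \<phi> + c)" if "\<phi> \<in> {0<..<\<Phi>}" for \<phi>
    using assms(2)[of \<phi>] that assms(4,5) by (intro divide_strict_left_mono mult_pos_pos) auto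
qed (use assms in simp)

lemma continuous_on_total_travel_time:
  fixes K :: "real \<Rightarrow> real"
  assumes "continuous_on {0..\<Phi>} K" "\<And>\<phi>. \<phi> \<in> {0..\<Phi>} \<Longrightarrow> 0 < K \<phi>"
  shows "continuous_on {0..} (\<lambda>c. travel_time (\<lambda>\<phi>. K \<phi> + c) \<Phi>)"
proof -
  have "continuous_on ({0..} \<times> {0..\<Phi>}) (\<lambda>(c, \<phi>). 1 / (K \<phi> + c))"
    unfolding case_prod_beta
  proof (intro continuous_intros)
    show "continuous_on ({0..} \<times> {0..\<Phi>}) (\<lambda>x. K (snd x))"
      by (rule continuous_on_compose2[OF assms(1)]) (auto intro: continuous_intros)
    show "\<forall>x\<in>{0..} \<times> {0..\<Phi>}. K (snd x) + fst x \<noteq> 0"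
    proof
      fix x :: "real \<times> real" assume "x \<in> {0..} \<times> {0..\<Phi>}"
      then show "K (snd x) + fst x \<noteq> 0"
        using assms(2)[of "snd x"] by auto
    qed
  qed
  then show ?thesis
    using integral_continuous_on_param[of "{0..}" 0 \<Phi> "\<lambda>c \<phi>. 1 / (K \<phi> + c)"]
    by (simp add: travel_time_def)
qed

text \<open>With velocity larger than \<open>\<Phi>\<close> on \<open>[0,\<Phi>]\<close>, less than unit time is needed for the distance
  \<open>\<Phi>\<close>. So the intermediate value theorem can look for a shift with travel time \<open>1\<close> in
  \<open>[0,\<Phi>]\<close>.\<close>

lemma total_travel_time_less_1:
  fixes K :: "real \<Rightarrow> real"
  assumes "continuous_on {0..\<Phi>} K" "\<And>\<phi>. \<phi> \<in> {0..\<Phi>} \<Longrightarrow> 0 < K \<phi>" "0 < \<Phi>"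
  shows "travel_time (\<lambda>\<phi>. K \<phi> + \<Phi>) \<Phi> < 1"
proof -
  have "travel_time (\<lambda>\<phi>. K \<phi> + \<Phi>) \<Phi> < integral {0..\<Phi>} (\<lambda>\<phi>. 1 / \<Phi>)"
    unfolding travel_time_def
  proof (rule integral_less_real)
    show "continuous_on {0..\<Phi>} (\<lambda>\<phi>. 1 / (K \<phi> + \<Phi>))"
      using assms(3)
      by (intro positive_velocity.continuous_on_slowness positive_velocity_shift assms(1-3)) auto
    show "1 / (K \<phi> + \<Phi>) < 1 / \<Phi>" if "\<phi> \<in> {0<..<\<Phi>}" for \<phi>
      using assms(2)[of \<phi>] that assms(3) by (intro divide_strict_left_mono mult_pos_pos) auto
  qed (use assms in auto)
  also have "\<dots> = 1" using assms(3) by simp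
  finally show ?thesis .
qed

theorem proposition5p4:
  fixes K :: "real \<Rightarrow> real" and \<Phi>\<^sub>F :: real
  assumes "0 < \<Phi>\<^sub>F"
    and "C2_real K"
    and "bounded (range (deriv K))"
    and "bounded (range (deriv (deriv K)))"
    and "\<forall>\<phi>\<in>{0..\<Phi>\<^sub>F}. 0 < K \<phi>"
  shows "(integral {0..\<Phi>\<^sub>F} (\<lambda>\<phi>. 1 / K \<phi>) > 1 \<longrightarrow>
            (\<exists>Q N. steady_state K \<Phi>\<^sub>F Q N \<and>
               (\<forall>R M. steady_state K \<Phi>\<^sub>F R M \<longrightarrow> M = N \<and> (\<forall>\<eta>\<in>{0..1}. R \<eta> = Q \<eta>)))) \<and>
         (integral {0..\<Phi>\<^sub>F} (\<lambda>\<phi>. 1 / K \<phi>) \<le> 1 \<longrightarrow>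
            \<not> (\<exists>Q N. steady_state K \<Phi>\<^sub>F Q N))"
proof -
  obtain K' where "\<And>x. (K has_real_derivative K' x) (at x)"
    using assms(2) unfolding C2_real_def C1_on_def by blast
  then have contK: "continuous_on {0..\<Phi>\<^sub>F} K"
    by (rule DERIV_continuous_on[OF DERIV_subset]) simp
  have posK: "\<And>\<phi>. \<phi> \<in> {0..\<Phi>\<^sub>F} \<Longrightarrow> 0 < K \<phi>" using assms(5) by blast
  note K = contK posK \<open>0 < \<Phi>\<^sub>F\<close>
  define T where "T = (\<lambda>c. travel_time (\<lambda>\<phi>. K \<phi> + c) \<Phi>\<^sub>F)"
  have T0: "integral {0..\<Phi>\<^sub>F} (\<lambda>\<phi>. 1 / K \<phi>) = T 0"
    by (simp add: T_def travel_time_def)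
  have T_anti: "T d < T c" if "0 \<le> c" "c < d" for c d
    using total_travel_time_strict_antimono[OF K that] by (simp add: T_def)
  have T_steady: "0 < M" "T (1 / M) = 1" if "steady_state K \<Phi>\<^sub>F R M" for R M
  proof -
    have M: "0 < M" "R 1 = \<Phi>\<^sub>F" using that unfolding steady_state_def by blast+
    show "0 < M" by (rule M)
    show "T (1 / M) = 1"
      using travel_time_along_steady_state(2)[OF K that, of 1] M(2) by (simp add: T_def)
  qed
  have unique: "M = N \<and> (\<forall>\<eta>\<in>{0..1}. R \<eta> = Q \<eta>)"
    if Q: "steady_state K \<Phi>\<^sub>F Q N" and R: "steady_state K \<Phi>\<^sub>F R M" for Q R N M
  proof -
    have "0 < 1 / M" "0 < 1 / N" using T_steady(1)[OF Q] T_steady(1)[OF R] by simp_all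
    then have "\<not> 1 / M < 1 / N" "\<not> 1 / N < 1 / M"
      using T_steady(2)[OF Q] T_steady(2)[OF R]
        T_anti[of "1 / M" "1 / N"] T_anti[of "1 / N" "1 / M"] by linarith+
    then have "1 / M = 1 / N" by linarith
    then have MN: "M = N" by simp
    have "R \<eta> = Q \<eta>" if "\<eta> \<in> {0..1}" for \<eta>
      by (rule steady_state_determined_by_N[OF contK posK \<open>0 < \<Phi>\<^sub>F\<close> R[unfolded MN] Q that])
    with MN show ?thesis by blast
  qed
  have exists: "\<exists>Q N. steady_state K \<Phi>\<^sub>F Q N" if gt1: "1 < T 0"
  proof -
    have "continuous_on {0..\<Phi>\<^sub>F} T"
      using continuous_on_total_travel_time[OF contK posK]
      by (auto simp: T_def intro: continuous_on_subset)
    moreover have "T \<Phi>\<^sub>F < 1"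
      using total_travel_time_less_1[OF K] by (simp add: T_def)
    ultimately obtain c where c: "0 \<le> c" "T c = 1"
      using IVT2'[of T \<Phi>\<^sub>F 1 0] gt1 \<open>0 < \<Phi>\<^sub>F\<close> by auto
    then have "0 < c" using gt1 by (auto simp: order.order_iff_strict)
    then show ?thesis
      using steady_state_of_travel_time[OF K, of "1 / c"] c by (auto simp: T_def)
  qed
  have "\<not> steady_state K \<Phi>\<^sub>F Q N" if "T 0 \<le> 1" for Q N
    using T_steady[of Q N] T_anti[of 0 "1 / N"] that by fastforce
  then show ?thesis
    unfolding T0 using exists unique by blast
qed

end
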